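(* Let $\langle\cdot,\cdot\rangle$ be an arbitrary inner product on $\mathbb{R}^n$ with induced norm $\|\cdot\|$; all notions (gradient, smoothness, averagedness) are taken in $(\mathbb{R}^n,\langle\cdot,\cdot\rangle)$. Let $f:\mathbb{R}^n\to\mathbb{R}$, $D:\mathbb{R}^n\to\mathbb{R}^n$ (not necessarily linear), $\beta>0$, and $\rho>\beta/2$. Let $T_{\mathrm{ISTA}} = D\circ(I-\rho^{-1}\nabla f)$. Suppose that (i) $f$ is convex and $\beta$-smooth, (ii) $D$ is $\theta$-averaged for some $\theta\in(0,1)$, and (iii) $\mathrm{fix}(T_{\mathrm{ISTA}})\neq\varnothing$. Then for any $x_0\in\mathbb{R}^n$, the sequence $(x_k)_{k\ge 0}$ generated by the PnP-ISTA iteration $$x_{k+1}=D\big(x_k-\rho^{-1}\nabla f(x_k)\big)$$ converges to some $x^\ast\in\mathrm{fix}(T_{\mathrm{ISTA}})$.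
   Context: Fix an inner product $\langle\cdot,\cdot\rangle$ on $\mathbb{R}^n$ with induced norm $\|x\|=\langle x,x\rangle^{1/2}$; $I$ is the identity operator on $\mathbb{R}^n$. Gradient: for a differentiable $f:\mathbb{R}^n\to\mathbb{R}$ with derivative $L(x):\mathbb{R}^n\to\mathbb{R}$ (a linear map) at $x$, $\nabla f(x)$ is the unique vector with $L(x)(h)=\langle\nabla f(x),h\rangle$ for all $h\in\mathbb{R}^n$. $\beta$-smooth: $f$ is differentiable and $\|\nabla f(x)-\nabla f(y)\|\le\beta\|x-y\|$ for all $x,y\in\mathbb{R}^n$. Non-expansive: $T:\mathbb{R}^n\to\mathbb{R}^n$ is non-expansive if $\|T(x)-T(y)\|\le\|x-y\|$ for all $x,y$. An operator $A$ is $\theta$-averaged, $\theta\in(0,1)$, if $A=(1-\theta)I+\theta T$ for some non-expansive $T$. $\mathrm{fix}(T)=\{x\in\mathbb{R}^n: T(x)=x\}$. *)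

theory Defs
  imports "HOL-Analysis.Analysis"
begin

text \<open>
  The space is \<open>real ^ 'n\<close> with an explicit inner product \<open>ip\<close>, in general different
  from the type class operation \<^const>\<open>inner\<close>. Topological notions that do not depend on
  the norm chosen on a finite-dimensional space (differentiability, limits of sequences)
  are those of the library.
\<close>

definition inner_product :: "(real ^ 'n \<Rightarrow> real ^ 'n \<Rightarrow> real) \<Rightarrow> bool" where
  "inner_product ip \<longleftrightarrow>
     bilinear ip \<and> (\<forall>x y. ip x y = ip y x) \<and> (\<forall>x. x \<noteq> 0 \<longrightarrow> 0 < ip x x)"

definition ip_norm :: "(real ^ 'n \<Rightarrow> real ^ 'n \<Rightarrow> real) \<Rightarrow> real ^ 'n \<Rightarrow> real" where
  "ip_norm ip x = sqrt (ip x x)"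

definition ip_gradient ::
  "(real ^ 'n \<Rightarrow> real ^ 'n \<Rightarrow> real) \<Rightarrow> (real ^ 'n \<Rightarrow> real) \<Rightarrow> real ^ 'n \<Rightarrow> real ^ 'n" where
  "ip_gradient ip f x = (THE g. \<forall>h. frechet_derivative f (at x) h = ip g h)"

definition ip_smooth ::
  "(real ^ 'n \<Rightarrow> real ^ 'n \<Rightarrow> real) \<Rightarrow> real \<Rightarrow> (real ^ 'n \<Rightarrow> real) \<Rightarrow> bool" where
  "ip_smooth ip \<beta> f \<longleftrightarrow>
     (\<forall>x. f differentiable (at x)) \<and>
     (\<forall>x y. ip_norm ip (ip_gradient ip f x - ip_gradient ip f y) \<le> \<beta> * ip_norm ip (x - y))"

definition nonexpansive ::
  "(real ^ 'n \<Rightarrow> real ^ 'n \<Rightarrow> real) \<Rightarrow> (real ^ 'n \<Rightarrow> real ^ 'n) \<Rightarrow> bool" where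
  "nonexpansive ip T \<longleftrightarrow> (\<forall>x y. ip_norm ip (T x - T y) \<le> ip_norm ip (x - y))"

definition averaged ::
  "(real ^ 'n \<Rightarrow> real ^ 'n \<Rightarrow> real) \<Rightarrow> real \<Rightarrow> (real ^ 'n \<Rightarrow> real ^ 'n) \<Rightarrow> bool" where
  "averaged ip \<theta> A \<longleftrightarrow>
     0 < \<theta> \<and> \<theta> < 1 \<and>
     (\<exists>T. nonexpansive ip T \<and> A = (\<lambda>x. (1 - \<theta>) *\<^sub>R x + \<theta> *\<^sub>R T x))"

definition fixed_points :: "('a \<Rightarrow> 'a) \<Rightarrow> 'a set" where
  "fixed_points T = {x. T x = x}"

definition T_ISTA ::
  "(real ^ 'n \<Rightarrow> real ^ 'n \<Rightarrow> real) \<Rightarrow> (real ^ 'n \<Rightarrow> real) \<Rightarrow> (real ^ 'n \<Rightarrow> real ^ 'n) \<Rightarrow> real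
    \<Rightarrow> real ^ 'n \<Rightarrow> real ^ 'n" where
  "T_ISTA ip f D \<rho> = D \<circ> (\<lambda>x. x - inverse \<rho> *\<^sub>R ip_gradient ip f x)"

end

theory Submission
  imports Defs
begin

text \<open>
  By the Baillon--Haddad inequality the gradient of \<open>f\<close> is cocoercive, so both factors of
  \<open>T_ISTA\<close> contract squared distances up to a defect term. Along the iteration from a fixed
  point \<open>p\<close>, the squared distance to \<open>p\<close> decreases at least by the defects, which are therefore
  null sequences; this forces \<open>x k - x (Suc k)\<close> to tend to \<open>0\<close>. A limit \<open>q\<close> of a convergent
  subsequence is then a fixed point, and the monotone squared distance to \<open>q\<close> tends to \<open>0\<close>.
\<close>

section \<open>Geometry of a finite-dimensional inner product space; gradients and averaged
  maps\<close>

locale ip_space =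
  fixes ip :: "real ^ 'n \<Rightarrow> real ^ 'n \<Rightarrow> real"
  assumes ip: "inner_product ip"
begin

lemma bil: "bilinear ip"
  and sym: "ip x y = ip y x"
  and pos: "x \<noteq> 0 \<Longrightarrow> 0 < ip x x"
  using ip unfolding inner_product_def by blast+

lemmas ip_simps =
  bilinear_ladd[OF bil] bilinear_radd[OF bil] bilinear_lsub[OF bil] bilinear_rsub[OF bil]
  bilinear_lmul[OF bil] bilinear_rmul[OF bil] bilinear_lzero[OF bil] bilinear_rzero[OF bil]
  bilinear_lneg[OF bil] bilinear_rneg[OF bil]

lemma nonneg: "0 \<le> ip x x"
  using pos[of x] by (cases "x = 0") (auto simp: ip_simps)

lemma ip_norm_le_iff: "ip_norm ip x \<le> ip_norm ip y \<longleftrightarrow> ip x x \<le> ip y y"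
  by (simp add: ip_norm_def)

lemma ip_norm_le_scaled:
  assumes "0 \<le> b"
  shows "ip_norm ip x \<le> b * ip_norm ip y \<longleftrightarrow> ip x x \<le> b\<^sup>2 * ip y y"
proof -
  have "b * ip_norm ip y = sqrt (b\<^sup>2 * ip y y)"
    using assms by (simp add: ip_norm_def real_sqrt_mult)
  then show ?thesis by (simp add: ip_norm_def)
qed

lemma bounded_bilinear_ip: "bounded_bilinear ip"
  using bil by (simp add: bilinear_conv_bounded_bilinear)

text \<open>The continuous function \<open>ip x x\<close> attains its minimum on the compact
  Euclidean unit sphere; the minimum is positive by definiteness and serves as \<open>m\<close>, and
  homogeneity extends the bound to all \<open>x\<close>. It carries bounds and limits in
  \<open>ip\<close> over to the library norm.\<close>

lemma ip_self_coercive: "\<exists>m>0. \<forall>x. m * (norm x)\<^sup>2 \<le> ip x x"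
proof -
  have cont: "continuous_on (sphere 0 1) (\<lambda>x. ip x x)"
    by (intro bounded_bilinear.continuous_on[OF bounded_bilinear_ip] continuous_intros)
  have "sphere (0 :: real ^ 'n) 1 \<noteq> {}" by simp
  from continuous_attains_inf[OF compact_sphere this cont]
  obtain u where u: "u \<in> sphere 0 1" "\<And>y. y \<in> sphere 0 1 \<Longrightarrow> ip u u \<le> ip y y"
    by blast
  have "ip u u * (norm x)\<^sup>2 \<le> ip x x" for x
  proof (cases "x = 0")
    case False
    define y where "y = x /\<^sub>R norm x"
    have "ip u u \<le> ip y y" using False by (intro u(2)) (simp add: y_def)
    moreover have "ip (norm x *\<^sub>R y) (norm x *\<^sub>R y) = (norm x)\<^sup>2 * ip y y"
      by (simp only: bilinear_lmul[OF bil] bilinear_rmul[OF bil]) (simp add: power2_eq_square)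
    moreover have "norm x *\<^sub>R y = x" using False by (simp add: y_def)
    ultimately show ?thesis by (simp add: mult.commute mult_right_mono)
  qed (simp add: ip_simps)
  moreover have "0 < ip u u" using u(1) by (intro pos) auto
  ultimately show ?thesis by blast
qed

lemma tendsto_0_if_ip_self:
  assumes "(\<lambda>k. ip (y k) (y k)) \<longlonglongrightarrow> 0"
  shows "y \<longlonglongrightarrow> 0"
proof -
  obtain m where m: "0 < m" "\<And>x. m * (norm x)\<^sup>2 \<le> ip x x" using ip_self_coercive by blast
  have "(\<lambda>k. ip (y k) (y k) / m) \<longlonglongrightarrow> 0" using tendsto_divide[OF assms tendsto_const, of m] m by simp
  then have "(\<lambda>k. (norm (y k))\<^sup>2) \<longlonglongrightarrow> 0"
    by (rule tendsto_sandwich[OF _ _ tendsto_const, rotated 2])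
      (use m in \<open>auto simp: field_simps\<close>)
  then have "(\<lambda>k. sqrt ((norm (y k))\<^sup>2)) \<longlonglongrightarrow> sqrt 0" by (rule tendsto_real_sqrt)
  then show ?thesis by (simp add: tendsto_norm_zero_iff)
qed

text \<open>The map \<open>A\<close> sends \<open>g\<close> to the coordinates of the functional
  \<open>ip g\<close>. Definiteness makes \<open>A\<close> injective, hence surjective between
  spaces of equal finite dimension. This justifies the definite description in
  \<open>ip_gradient\<close>.\<close>

lemma riesz:
  assumes "linear L"
  shows "\<exists>!g. \<forall>h. L h = ip g h"
proof -
  define A where "A g = (\<chi> i. ip g (axis i 1))" for g
  have lin: "linear A"
    by (rule linearI) (auto simp: A_def vec_eq_iff ip_simps)
  have expand: "M h = (\<Sum>i\<in>UNIV. h $ i * M (axis i 1))" if "linear M" for M :: "real ^ 'n \<Rightarrow> real" and h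
  proof -
    have "M h = M (\<Sum>i\<in>UNIV. h $ i *\<^sub>R axis i 1)"
      using basis_expansion[of h] by (simp add: scalar_mult_eq_scaleR)
    then show ?thesis by (simp add: linear_sum[OF that] linear_cmul[OF that])
  qed
  have linip: "linear (ip g)" for g using bil by (simp add: bilinear_def)
  have "inj A"
  proof (subst linear_injective_0[OF lin], intro allI impI)
    fix g assume "A g = 0"
    then have "ip g (axis i 1) = 0" for i by (auto simp: A_def vec_eq_iff)
    then have "ip g g = 0" using expand[OF linip, of g g] by simp
    then show "g = 0" using pos[of g] by auto
  qed
  then obtain g where "A g = (\<chi> i. L (axis i 1))"
    using linear_injective_imp_surjective[OF lin] by (metis surj_def)
  then have "ip g (axis i 1) = L (axis i 1)" for i by (simp add: A_def vec_eq_iff)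
  then have g: "L h = ip g h" for h using expand[OF assms, of h] expand[OF linip, of g h] by simp
  moreover have "g' = g" if "\<forall>h. L h = ip g' h" for g'
  proof (rule ccontr)
    assume "g' \<noteq> g"
    then have "0 < ip (g' - g) (g' - g)" using pos[of "g' - g"] by simp
    moreover have "ip (g' - g) (g' - g) = 0"
      using that g[of "g' - g"] by (subst bilinear_lsub[OF bil]) simp
    ultimately show False by simp
  qed
  ultimately show ?thesis by blast
qed

lemma ip_gradient_has_derivative:
  assumes "f differentiable (at x)"
  shows "(f has_derivative ip (ip_gradient ip f x)) (at x)"
proof -
  have d: "(f has_derivative frechet_derivative f (at x)) (at x)"
    using assms by (simp add: frechet_derivative_works)
  have "\<forall>h. frechet_derivative f (at x) h = ip (ip_gradient ip f x) h"
    unfolding ip_gradient_def by (rule theI'[OF riesz[OF has_derivative_linear[OF d]]])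
  then have "frechet_derivative f (at x) = ip (ip_gradient ip f x)" by blast
  with d show ?thesis by simp
qed

text \<open>A square-root-free form of Cauchy-Schwarz, obtained by expanding the nonnegative square
  of \<open>u - s *\<^sub>R d\<close>. It turns the Lipschitz bound on the gradient into a bound on
  a directional derivative.\<close>

lemma ip_le_if_ip_self_le:
  assumes "ip u u \<le> s\<^sup>2 * ip d d" "0 < s"
  shows "ip u d \<le> s * ip d d"
proof -
  have "0 \<le> ip (u - s *\<^sub>R d) (u - s *\<^sub>R d)" by (rule nonneg)
  also have "\<dots> = ip u u - 2 * s * ip u d + s\<^sup>2 * ip d d"
    by (simp add: ip_simps sym[of d u] power2_eq_square algebra_simps)
  finally have "s * ip u d \<le> s * (s * ip d d)"
    using assms(1) by (simp add: power2_eq_square)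
  then show ?thesis using assms(2) by simp
qed

text \<open>The squared norm of a convex combination of \<open>a\<close> and \<open>b\<close> is the
  combination of the squared norms minus \<theta> (1 - \<theta>) times the squared norm of
  \<open>a - b\<close>. The defect is \<theta> times \<open>a - b\<close>, which gives the
  coefficient (1 - \<theta>) / \<theta>.\<close>

lemma averaged_ip_self_le:
  assumes "averaged ip \<theta> D"
  shows "ip (D u - D v) (D u - D v) \<le> ip (u - v) (u - v)
    - (1 - \<theta>) / \<theta> * ip ((u - v) - (D u - D v)) ((u - v) - (D u - D v))"
proof -
  obtain T where \<theta>: "0 < \<theta>" "\<theta> < 1" and T: "nonexpansive ip T"
    and D: "D = (\<lambda>x. (1 - \<theta>) *\<^sub>R x + \<theta> *\<^sub>R T x)"
    using assms unfolding averaged_def by blast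
  define a where "a = u - v"
  define b where "b = T u - T v"
  have Da: "D u - D v = (1 - \<theta>) *\<^sub>R a + \<theta> *\<^sub>R b" by (simp add: D a_def b_def algebra_simps)
  have ab: "a - (D u - D v) = \<theta> *\<^sub>R (a - b)" by (simp add: Da algebra_simps)
  have "ip b b \<le> ip a a"
    using T by (simp add: nonexpansive_def ip_norm_le_iff a_def b_def)
  then have "\<theta> * ip b b \<le> \<theta> * ip a a" using \<theta> by simp
  moreover have "ip (D u - D v) (D u - D v)
      = (1 - \<theta>) * ip a a + \<theta> * ip b b - \<theta> * (1 - \<theta>) * ip (a - b) (a - b)"
    by (simp add: Da ip_simps sym[of b a] algebra_simps power2_eq_square)
  moreover have "(1 - \<theta>) / \<theta> * ip (\<theta> *\<^sub>R (a - b)) (\<theta> *\<^sub>R (a - b)) = \<theta> * (1 - \<theta>) * ip (a - b) (a - b)"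
    using \<theta> by (simp only: bilinear_lmul[OF bil] bilinear_rmul[OF bil]) (simp add: field_simps)
  ultimately show ?thesis
    unfolding a_def[symmetric] ab by (simp add: algebra_simps)
qed

end

section \<open>Smooth convex functions: cocoercivity of the gradient and the gradient step\<close>

locale ip_smooth_convex = ip_space ip for ip :: "real ^ 'n \<Rightarrow> real ^ 'n \<Rightarrow> real" +
  fixes f :: "real ^ 'n \<Rightarrow> real" and \<beta> :: real
  assumes beta_pos: "0 < \<beta>"
    and convex: "convex_on UNIV f"
    and smooth: "ip_smooth ip \<beta> f"
begin

abbreviation grad :: "real ^ 'n \<Rightarrow> real ^ 'n" where
  "grad \<equiv> ip_gradient ip f"

lemma grad_lipschitz:
  "ip (grad x - grad y) (grad x - grad y) \<le> \<beta>\<^sup>2 * ip (x - y) (x - y)"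
  using smooth beta_pos unfolding ip_smooth_def by (simp add: ip_norm_le_scaled)

lemma deriv_along_line:
  "((\<lambda>t. f (x + t *\<^sub>R d)) has_real_derivative ip (grad (x + t *\<^sub>R d)) d) (at t within S)"
proof -
  have "(f has_derivative ip (grad (x + t *\<^sub>R d))) (at (x + t *\<^sub>R d))"
    using smooth unfolding ip_smooth_def by (intro ip_gradient_has_derivative) blast
  moreover have "((\<lambda>t. x + t *\<^sub>R d) has_derivative (\<lambda>s. s *\<^sub>R d)) (at t within S)"
    by (auto intro!: derivative_eq_intros)
  ultimately have "((\<lambda>t. f (x + t *\<^sub>R d)) has_derivative (\<lambda>s. ip (grad (x + t *\<^sub>R d)) (s *\<^sub>R d))) (at t within S)"
    by (rule has_derivative_compose[rotated])
  then show ?thesis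
    by (simp add: has_field_derivative_def ip_simps mult.commute[of _ "ip _ _"])
qed

text \<open>Restricting \<open>f\<close> to the line through \<open>x\<close> and \<open>z\<close>
  reduces this to the tangent inequality for convex functions of one real variable.\<close>

lemma above_tangent: "f x + ip (grad x) (z - x) \<le> f z"
proof -
  define \<phi> where "\<phi> t = f (x + t *\<^sub>R (z - x))" for t
  have "convex_on UNIV \<phi>"
  proof (rule convex_onI)
    fix t a b :: real
    assume t: "0 < t" "t < 1"
    have "x + ((1 - t) *\<^sub>R a + t *\<^sub>R b) *\<^sub>R (z - x)
        = (1 - t) *\<^sub>R (x + a *\<^sub>R (z - x)) + t *\<^sub>R (x + b *\<^sub>R (z - x))"
      by (simp add: algebra_simps)
    then show "\<phi> ((1 - t) *\<^sub>R a + t *\<^sub>R b) \<le> (1 - t) * \<phi> a + t * \<phi> b"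
      using convex_onD[OF convex, of t] t by (simp add: \<phi>_def)
  qed simp
  moreover have "(\<phi> has_real_derivative ip (grad x) (z - x)) (at 0)"
    using deriv_along_line[of x "z - x" 0 UNIV] by (simp add: \<phi>_def[abs_def])
  ultimately have "\<phi> 1 - \<phi> 0 \<ge> ip (grad x) (z - x) * (1 - 0)"
    by (intro convex_on_imp_above_tangent[of UNIV]) auto
  then show ?thesis by (simp add: \<phi>_def)
qed

text \<open>Along the segment, subtracting the linear and quadratic terms from \<open>f\<close>
  leaves a function \<open>\<psi>\<close> whose derivative is nonpositive for nonnegative arguments;
  comparing \<open>\<psi> 1\<close> with \<open>\<psi> 0\<close> replaces integration of the
  gradient.\<close>

lemma descent: "f z \<le> f x + ip (grad x) (z - x) + \<beta> / 2 * ip (z - x) (z - x)"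
proof -
  define d where "d = z - x"
  define \<psi> where "\<psi> t = f (x + t *\<^sub>R d) - t * ip (grad x) d - \<beta> / 2 * t\<^sup>2 * ip d d" for t
  have "\<exists>y. (\<psi> has_real_derivative y) (at t) \<and> y \<le> 0" if "0 \<le> t" for t
  proof (intro exI conjI)
    show "(\<psi> has_real_derivative (ip (grad (x + t *\<^sub>R d)) d - ip (grad x) d - \<beta> * t * ip d d)) (at t)"
      unfolding \<psi>_def[abs_def] by (auto intro!: derivative_eq_intros deriv_along_line)
    show "ip (grad (x + t *\<^sub>R d)) d - ip (grad x) d - \<beta> * t * ip d d \<le> 0"
    \<comment> \<open>\<open>ip_le_if_ip_self_le\<close> is applied with the factor
      \<open>\<beta> * t\<close>, which must be strictly positive; at \<open>t = 0\<close> the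
      derivative vanishes.\<close>
    proof (cases "t = 0")
      case False
      have "ip (grad (x + t *\<^sub>R d) - grad x) d \<le> (\<beta> * t) * ip d d"
        using grad_lipschitz[of "x + t *\<^sub>R d" x] that False beta_pos
        by (intro ip_le_if_ip_self_le) (auto simp: bilinear_lmul[OF bil] bilinear_rmul[OF bil] power2_eq_square algebra_simps)
      then show ?thesis by (simp add: ip_simps)
    qed simp
  qed
  then have "\<psi> 1 \<le> \<psi> 0" by (intro DERIV_nonpos_imp_nonincreasing[of 0 1 \<psi>]) auto
  then show ?thesis by (simp add: \<psi>_def d_def)
qed

text \<open>At a common point \<open>z\<close>, the tangent at \<open>x\<close> bounds
  \<open>f\<close> from below and the descent estimate at \<open>y\<close> bounds it from above. The
  linear terms gain 1 / \<beta> times \<open>ip w w\<close> and the quadratic term costs half of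
  that.\<close>

lemma above_tangent_strong:
  "f x + ip (grad x) (y - x) + 1 / (2 * \<beta>) * ip (grad x - grad y) (grad x - grad y) \<le> f y"
proof -
  define w where "w = grad x - grad y"
  \<comment> \<open>This \<open>z\<close> minimises the descent bound at \<open>y\<close> minus the tangent at \<open>x\<close>.\<close>
  define z where "z = y + (1 / \<beta>) *\<^sub>R w"
  have "f x + ip (grad x) (z - x) \<le> f y + ip (grad y) (z - y) + \<beta> / 2 * ip (z - y) (z - y)"
    using above_tangent descent by (rule order_trans)
  moreover have "ip (grad x) (z - x) - ip (grad y) (z - y) = ip (grad x) (y - x) + 1 / \<beta> * ip w w"
    by (simp add: z_def w_def ip_simps algebra_simps diff_divide_distrib)
  moreover have "\<beta> / 2 * ip (z - y) (z - y) = 1 / (2 * \<beta>) * ip w w"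
    using beta_pos by (simp add: z_def ip_simps)
  ultimately show ?thesis unfolding w_def[symmetric] by (simp add: field_simps)
qed

text \<open>Adding the strengthened tangent inequality to itself with \<open>x\<close> and
  \<open>y\<close> exchanged cancels the values of \<open>f\<close>.\<close>

lemma baillon_haddad:
  "ip (grad x - grad y) (grad x - grad y) \<le> \<beta> * ip (grad x - grad y) (x - y)"
proof -
  have "ip (grad x) (y - x) + ip (grad y) (x - y) = - ip (grad x - grad y) (x - y)"
    by (simp add: ip_simps)
  moreover have "ip (grad y - grad x) (grad y - grad x) = ip (grad x - grad y) (grad x - grad y)"
    by (simp add: ip_simps)
  ultimately have "1 / \<beta> * ip (grad x - grad y) (grad x - grad y) \<le> ip (grad x - grad y) (x - y)"
    using above_tangent_strong[of x y] above_tangent_strong[of y x] by (simp add: field_simps)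
  then show ?thesis using beta_pos by (simp add: field_simps)
qed

text \<open>Expand the square and bound the cross term by cocoercivity, so that only squared
  gradient differences remain beside the squared distance.\<close>

lemma gradient_step_ip_self_le:
  fixes \<rho> :: real
  assumes "0 < \<rho>"
  defines "G \<equiv> \<lambda>x. x - inverse \<rho> *\<^sub>R grad x"
  shows "ip (G x - G y) (G x - G y) \<le> ip (x - y) (x - y)
    - inverse \<rho> * (2 / \<beta> - inverse \<rho>) * ip (grad x - grad y) (grad x - grad y)"
proof -
  define a where "a = x - y"
  define w where "w = grad x - grad y"
  have "G x - G y = a - inverse \<rho> *\<^sub>R w" by (simp add: G_def a_def w_def algebra_simps)
  then have "ip (G x - G y) (G x - G y) = ip (a - inverse \<rho> *\<^sub>R w) (a - inverse \<rho> *\<^sub>R w)"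
    by (rule arg_cong[where f = "\<lambda>v. ip v v"])
  also have "\<dots> = ip a a - 2 * inverse \<rho> * ip w a + inverse \<rho> * inverse \<rho> * ip w w"
    by (simp add: ip_simps sym[of a w] algebra_simps)
  finally have "ip (G x - G y) (G x - G y)
      = ip a a - 2 * inverse \<rho> * ip w a + inverse \<rho> * inverse \<rho> * ip w w" .
  moreover have "inverse \<rho> * (2 / \<beta> * ip w w) \<le> inverse \<rho> * (2 * ip w a)"
    using baillon_haddad[of x y] assms(1) beta_pos
    by (intro mult_left_mono) (auto simp: a_def w_def field_simps)
  ultimately show ?thesis unfolding a_def[symmetric] w_def[symmetric] by (simp add: algebra_simps)
qed

end

section \<open>Fejer monotone sequences and convergence of the PnP-ISTA iteration\<close>

lemma (in ip_space) fejer_tendsto: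
  assumes T: "nonexpansive ip T"
    and p: "T p = p"
    and step: "\<And>k. x (Suc k) = T (x k)"
    and reg: "(\<lambda>k. x k - x (Suc k)) \<longlonglongrightarrow> 0"
  shows "\<exists>q. T q = q \<and> x \<longlonglongrightarrow> q"
proof -
  obtain m where m: "0 < m" "\<And>x. m * (norm x)\<^sup>2 \<le> ip x x" using ip_self_coercive by blast
  have T': "ip (T u - T v) (T u - T v) \<le> ip (u - v) (u - v)" for u v
    using T by (simp add: nonexpansive_def ip_norm_le_iff)
  \<comment> \<open>Stated for an arbitrary fixed point: it is used for \<open>p\<close> to bound
    the sequence, and later for the cluster point \<open>q\<close>.\<close>
  have dec: "decseq (\<lambda>k. ip (x k - q) (x k - q))" if "T q = q" for q
    using T'[of _ q] that by (intro decseq_SucI) (simp add: step)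
  have "norm (x k - p) \<le> sqrt (ip (x 0 - p) (x 0 - p) / m)" for k
  proof (rule real_le_rsqrt)
    have "m * (norm (x k - p))\<^sup>2 \<le> ip (x 0 - p) (x 0 - p)"
      using m(2)[of "x k - p"] decseqD[OF dec[OF p], of 0 k] by simp
    then show "(norm (x k - p))\<^sup>2 \<le> ip (x 0 - p) (x 0 - p) / m" using m(1) by (simp add: field_simps)
  qed
  then have "range x \<subseteq> cball p (sqrt (ip (x 0 - p) (x 0 - p) / m))"
    by (auto simp: dist_norm norm_minus_commute)
  then obtain q r where r: "strict_mono r" and lim: "(x \<circ> r) \<longlonglongrightarrow> q"
    using compact_cball[unfolded compact_def] by (metis rangeI subset_iff)
  have ip0: "(\<lambda>k. ip (y k) (y k)) \<longlonglongrightarrow> 0" if "y \<longlonglongrightarrow> 0" for y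
    using bounded_bilinear.tendsto[OF bounded_bilinear_ip that that] by (simp add: ip_simps)
  have sub: "(\<lambda>k. ip (x (r k) - q) (x (r k) - q)) \<longlonglongrightarrow> 0"
    using lim by (intro ip0) (simp add: LIM_zero_iff o_def)
  \<comment> \<open>Nonexpansiveness gives continuity of \<open>T\<close> at \<open>q\<close>; with
    vanishing differences \<open>x k - T (x k)\<close>, the subsequence also tends to
    \<open>T q\<close>, so uniqueness of limits yields \<open>T q = q\<close>.\<close>
  have "(\<lambda>k. T (x (r k)) - T q) \<longlonglongrightarrow> 0"
    by (rule tendsto_0_if_ip_self, rule tendsto_sandwich[OF _ _ tendsto_const sub])
      (auto simp: nonneg T')
  moreover have "(\<lambda>k. x (r k) - T (x (r k))) \<longlonglongrightarrow> 0"
    using LIMSEQ_subseq_LIMSEQ[OF reg r] by (simp add: o_def step)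
  ultimately have "(\<lambda>k. x (r k) - T q) \<longlonglongrightarrow> 0" using tendsto_add by fastforce
  then have "(x \<circ> r) \<longlonglongrightarrow> T q" by (simp add: LIM_zero_iff o_def)
  with lim have q: "T q = q" using LIMSEQ_unique by blast
  \<comment> \<open>Monotonicity makes the whole sequence of squared distances converge, and the
    subsequence identifies its limit as 0.\<close>
  have "convergent (\<lambda>k. ip (x k - q) (x k - q))"
    using decseq_convergent[OF dec[OF q], of 0] nonneg by (metis convergentI)
  then obtain l where l: "(\<lambda>k. ip (x k - q) (x k - q)) \<longlonglongrightarrow> l" by (auto simp: convergent_def)
  moreover have "l = 0"
    using LIMSEQ_unique[OF LIMSEQ_subseq_LIMSEQ[OF l r]] sub by (simp add: o_def)
  ultimately have "(\<lambda>k. x k - q) \<longlonglongrightarrow> 0" using l by (intro tendsto_0_if_ip_self) simp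
  then show ?thesis using q by (auto simp: LIM_zero_iff)
qed

theorem mainTheorem1:
  fixes ip :: "real ^ 'n \<Rightarrow> real ^ 'n \<Rightarrow> real"
    and f :: "real ^ 'n \<Rightarrow> real"
    and D :: "real ^ 'n \<Rightarrow> real ^ 'n"
    and \<beta> \<rho> :: real
    and x0 :: "real ^ 'n"
    and x :: "nat \<Rightarrow> real ^ 'n"
  assumes "inner_product ip"
    and "\<beta> > 0"
    and "\<rho> > \<beta> / 2"
    and "convex_on UNIV f"
    and "ip_smooth ip \<beta> f"
    and "\<exists>\<theta>. 0 < \<theta> \<and> \<theta> < 1 \<and> averaged ip \<theta> D"
    and "fixed_points (T_ISTA ip f D \<rho>) \<noteq> {}"
    and "x 0 = x0"
    and "\<And>k. x (Suc k) = D (x k - inverse \<rho> *\<^sub>R ip_gradient ip f (x k))"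
  shows "\<exists>x_star \<in> fixed_points (T_ISTA ip f D \<rho>). x \<longlonglongrightarrow> x_star"
proof -
  interpret ip_smooth_convex ip f \<beta>
    using assms by unfold_locales
  obtain \<theta> where \<theta>: "0 < \<theta>" "\<theta> < 1" "averaged ip \<theta> D" using assms(6) by blast
  define G where "G = (\<lambda>u. u - inverse \<rho> *\<^sub>R grad u)"
  define T where "T = T_ISTA ip f D \<rho>"
  have TG: "T u = D (G u)" for u by (simp add: T_def T_ISTA_def G_def)
  have step: "x (Suc k) = T (x k)" for k by (simp add: assms(9) TG G_def)
  define c where "c = inverse \<rho> * (2 / \<beta> - inverse \<rho>)"
  define \<kappa> where "\<kappa> = (1 - \<theta>) / \<theta>"
  have rho: "0 < \<rho>" using assms by linarith
  \<comment> \<open>Positivity of \<open>c\<close> amounts to 1 / \<rho> < 2 / \<beta>; this is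
    where the step size condition \<rho> > \<beta> / 2 enters.\<close>
  have c: "0 < c" using assms rho by (auto simp: c_def field_simps)
  have \<kappa>: "0 < \<kappa>" using \<theta> by (simp add: \<kappa>_def)
  \<comment> \<open>The defect of \<open>D\<close> between the points \<open>G u\<close> and
    \<open>G v\<close>, as in \<open>averaged_ip_self_le\<close>.\<close>
  define R where "R u v = (G u - G v) - (T u - T v)" for u v
  have decr: "ip (T u - T v) (T u - T v) + c * ip (grad u - grad v) (grad u - grad v)
      + \<kappa> * ip (R u v) (R u v) \<le> ip (u - v) (u - v)" for u v
    using averaged_ip_self_le[OF \<theta>(3), of "G u" "G v"] gradient_step_ip_self_le[OF rho, of u v]
    by (simp add: TG R_def c_def \<kappa>_def G_def)
  have "ip (T u - T v) (T u - T v) \<le> ip (u - v) (u - v)" for u v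
    using decr[of u v] mult_nonneg_nonneg[OF less_imp_le[OF c] nonneg[of "grad u - grad v"]]
      mult_nonneg_nonneg[OF less_imp_le[OF \<kappa>] nonneg[of "R u v"]] by linarith
  then have T: "nonexpansive ip T" by (simp add: nonexpansive_def ip_norm_le_iff)
  obtain p where p: "T p = p" using assms(7) by (auto simp: fixed_points_def T_def)
  define e where "e k = ip (x k - p) (x k - p)" for k
  have e: "e (Suc k) + c * ip (grad (x k) - grad p) (grad (x k) - grad p)
      + \<kappa> * ip (R (x k) p) (R (x k) p) \<le> e k" for k
    using decr[of "x k" p] by (simp add: e_def step p)
  have nn: "0 \<le> c * ip w w" "0 \<le> \<kappa> * ip w w" for w using c \<kappa> nonneg[of w] by auto
  have "decseq e"
    by (rule decseq_SucI) (use e nn in \<open>smt (verit)\<close>)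
  then obtain l where l: "e \<longlonglongrightarrow> l"
    using decseq_convergent[of e 0] nonneg unfolding e_def by blast
  have diff: "(\<lambda>k. e k - e (Suc k)) \<longlonglongrightarrow> 0"
    using tendsto_diff[OF l LIMSEQ_Suc[OF l]] by simp
  \<comment> \<open>The decrements of the convergent sequence \<open>e\<close> tend to 0 and
    dominate each of the two defect terms separately.\<close>
  have null: "y \<longlonglongrightarrow> 0" if "0 < a" "\<And>k. a * ip (y k) (y k) \<le> e k - e (Suc k)" for a y
  proof (rule tendsto_0_if_ip_self, rule tendsto_sandwich[OF _ _ tendsto_const])
    show "(\<lambda>k. (e k - e (Suc k)) / a) \<longlonglongrightarrow> 0"
      using tendsto_divide[OF diff tendsto_const, of a] that by simp
    show "\<forall>\<^sub>F k in sequentially. ip (y k) (y k) \<le> (e k - e (Suc k)) / a"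
      using that by (simp add: field_simps)
  qed (simp add: nonneg)
  have grad0: "(\<lambda>k. grad (x k) - grad p) \<longlonglongrightarrow> 0"
    by (rule null[OF c]) (use e nn in \<open>smt (verit)\<close>)
  have R0: "(\<lambda>k. R (x k) p) \<longlonglongrightarrow> 0"
    by (rule null[OF \<kappa>]) (use e nn in \<open>smt (verit)\<close>)
  \<comment> \<open>Since \<open>T p = p\<close>, the terms in \<open>p\<close> cancel and the
    increment splits into the two defects, both already known to vanish in the limit.\<close>
  have "x k - x (Suc k) = R (x k) p + inverse \<rho> *\<^sub>R (grad (x k) - grad p)" for k
    by (simp add: R_def step p G_def algebra_simps)
  moreover have "(\<lambda>k. R (x k) p + inverse \<rho> *\<^sub>R (grad (x k) - grad p)) \<longlonglongrightarrow> 0 + inverse \<rho> *\<^sub>R 0"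
    by (intro tendsto_intros R0 grad0)
  ultimately have "(\<lambda>k. x k - x (Suc k)) \<longlonglongrightarrow> 0" by simp
  from fejer_tendsto[OF T p step this] show ?thesis
    by (auto simp: fixed_points_def T_def)
qed

end
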